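(* Let $L>0$, let $f$ be an even $C^2$ real-valued function on $I=[-L,L]$ with $f''>0$ on $I$, let $B=\{u\in\mathbb{R}^2:|u|\le L\}$, $\gamma(u)=f(|u|)$ for $u\in B$, and let $\Gamma=\{(u,\gamma(u)):u\in B\}\subset\mathbb{R}^3$. Let $E\subset\mathbb{R}^3$ be a compact set supporting a Borel probability measure $\mu$ for which there is a constant $b$ with $\mu(B(x,r))\le b\,r^t$ for all $x\in E$, $0<r<\infty$. Then: (i) the family of surface projections is $1$-transversal: with $A=\{\alpha\in\mathbb{R}^2:|\alpha|\le L/3\}$, $\Omega=\{\mathbf a\in\mathbb{R}^3:|\mathbf a|\le L/3\}$ and $\Phi_\alpha(\mathbf a)=a_3+\gamma(\alpha_1-a_1,\alpha_2-a_2)$ for $\alpha=(\alpha_1,\alpha_2)\in A$, $\mathbf a=(a_1,a_2,a_3)\in\Omega$, there are constants $c>0$, $\delta_0>0$ such that for all distinct $\mathbf a,\mathbf b\in\Omega$ and $0<\delta\le\delta_0$, $$\big|\{\alpha\in A:|\Phi_\alpha(\mathbf a)-\Phi_\alpha(\mathbf b)|\le\delta\}\big|<c\,\frac{\delta}{|\mathbf a-\mathbf b|},$$ where the outer $|\cdot|$ on the left is two-dimensional Lebesgue measure; (ii) if $t<1$, there is a constant $c'>0$ such that $\operatorname{Fav}_{\Gamma,3}(E(r))\ge c'\,r^{1-t}$ for all sufficiently small $r>0$; (iii) if $t=1$, there is a constant $c'>0$ such that $\operatorname{Fav}_{\Gamma,3}(E(r))\ge c'\,(\log r^{-1})^{-1}$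 for all sufficiently small $r>0$.
   Context: $E(r)=\{x:\operatorname{dist}(x,E)<r\}$. For $\alpha\in\mathbb{R}^2$ and $p\in\mathbb{R}^3$ let $\Phi_\alpha(p)=\{\beta\in\mathbb{R}:(\alpha,\beta)\in p+\Gamma\}$ (a set with at most one element when $\Gamma$ is a graph, identified with that element when nonempty), and $\Phi_\alpha(S)=\bigcup_{p\in S}\Phi_\alpha(p)$ for $S\subseteq\mathbb{R}^3$. The Favard surface length of $S$ is $$\operatorname{Fav}_{\Gamma,3}(S)=\big|\{(\alpha,\beta)\in\mathbb{R}^2\times\mathbb{R}:\beta\in\Phi_\alpha(S)\}\big|=\int_{\mathbb{R}^2}|\Phi_\alpha(S)|\,d\alpha,$$ with $|\cdot|$ Lebesgue measure of the appropriate dimension (3 in the first expression, 1 in the integrand). *)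

theory Defs
  imports "HOL-Analysis.Analysis" "HOL-Probability.Probability_Measure"
begin

text \<open>
  Euclidean 3-space is represented as \<^typ>\<open>(real^2) \<times> real\<close>: a point \<open>(a\<^sub>1, a\<^sub>2, a\<^sub>3)\<close> is the pair
  of \<open>(a\<^sub>1, a\<^sub>2)\<close> and \<open>a\<^sub>3\<close>. The library's norm and Lebesgue measure on this product are the
  Euclidean ones.
\<close>

definition gamma :: "(real \<Rightarrow> real) \<Rightarrow> real^2 \<Rightarrow> real" where
  "gamma f u = f (norm u)"

definition surface :: "real \<Rightarrow> (real \<Rightarrow> real) \<Rightarrow> ((real^2) \<times> real) set" where
  "surface L f = (\<lambda>u. (u, gamma f u)) ` cball 0 L"

definition Phi :: "((real^2) \<times> real) set \<Rightarrow> real^2 \<Rightarrow> (real^2) \<times> real \<Rightarrow> real set" where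
  "Phi \<Gamma> \<alpha> p = {\<beta>. (\<alpha>, \<beta>) \<in> (+) p ` \<Gamma>}"

definition Phi_set :: "((real^2) \<times> real) set \<Rightarrow> real^2 \<Rightarrow> ((real^2) \<times> real) set \<Rightarrow> real set" where
  "Phi_set \<Gamma> \<alpha> S = (\<Union>p\<in>S. Phi \<Gamma> \<alpha> p)"

definition Fav :: "((real^2) \<times> real) set \<Rightarrow> ((real^2) \<times> real) set \<Rightarrow> ennreal" where
  "Fav \<Gamma> S = emeasure lebesgue {(\<alpha>, \<beta>). \<beta> \<in> Phi_set \<Gamma> \<alpha> S}"

definition Phi_pt :: "(real \<Rightarrow> real) \<Rightarrow> real^2 \<Rightarrow> (real^2) \<times> real \<Rightarrow> real" where
  "Phi_pt f \<alpha> a = snd a + gamma f (\<alpha> - fst a)"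

definition thickening :: "('a::metric_space) set \<Rightarrow> real \<Rightarrow> 'a set" where
  "thickening E r = {x. infdist x E < r}"

text \<open>
  The first lemma justifies identifying the set \<^const>\<open>Phi\<close> of the graph with the number
  \<^const>\<open>Phi_pt\<close>; the last one is the slicing formula for \<^const>\<open>Fav\<close>.
\<close>

lemma Phi_surface:
  "Phi (surface L f) \<alpha> a = (if norm (\<alpha> - fst a) \<le> L then {Phi_pt f \<alpha> a} else {})"
proof -
  have "(\<alpha>, \<beta>) \<in> (+) a ` surface L f \<longleftrightarrow> norm (\<alpha> - fst a) \<le> L \<and> \<beta> = Phi_pt f \<alpha> a" for \<beta>
    by (cases a)
      (auto simp: surface_def Phi_pt_def image_iff algebra_simps intro!: bexI[of _ "\<alpha> - fst a"])
  then show ?thesis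
    by (auto simp: Phi_def)
qed

lemma open_Phi_set_graph:
  assumes "open S"
  shows "open {(\<alpha>, \<beta>). \<beta> \<in> Phi_set \<Gamma> \<alpha> S}"
proof -
  have "{(\<alpha>, \<beta>). \<beta> \<in> Phi_set \<Gamma> \<alpha> S} = (\<Union>g\<in>\<Gamma>. (+) g ` S)"
    by (force simp: Phi_set_def Phi_def image_iff add.commute)
  then show ?thesis
    using assms by (auto intro: open_translation)
qed

lemma Fav_eq_nn_integral:
  assumes "open S"
  shows "Fav \<Gamma> S = (\<integral>\<^sup>+\<alpha>. emeasure lebesgue (Phi_set \<Gamma> \<alpha> S) \<partial>lebesgue)"
proof -
  let ?G = "{(\<alpha>, \<beta>). \<beta> \<in> Phi_set \<Gamma> \<alpha> S}"
  have G: "?G \<in> sets (lborel \<Otimes>\<^sub>M lborel)"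
    unfolding lborel_prod using open_Phi_set_graph[OF assms, of \<Gamma>] by simp
  have slice: "Pair \<alpha> -` ?G = Phi_set \<Gamma> \<alpha> S" for \<alpha>
    by auto
  have meas: "Phi_set \<Gamma> \<alpha> S \<in> sets lborel" for \<alpha>
    using sets_Pair1[OF G, of \<alpha>] by (simp only: slice)
  have "Fav \<Gamma> S = emeasure (lborel \<Otimes>\<^sub>M lborel) ?G"
    using G unfolding Fav_def lborel_prod by simp
  also have "\<dots> = (\<integral>\<^sup>+\<alpha>. emeasure lborel (Phi_set \<Gamma> \<alpha> S) \<partial>lborel)"
    by (simp only: lborel.emeasure_pair_measure_alt[OF G] slice)
  also have "\<dots> = (\<integral>\<^sup>+\<alpha>. emeasure lebesgue (Phi_set \<Gamma> \<alpha> S) \<partial>lebesgue)"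
    using meas by (simp add: nn_integral_completion emeasure_completion)
  finally show ?thesis .
qed

end

theory Submission
  imports Defs
begin

text \<open>
  If \<open>f'' \<ge> m > 0\<close>, then \<open>u \<mapsto> f |u| - m |u|\<^sup>2 / 2\<close> is convex on the disc. Hence the difference of the
  projections of two points with horizontal displacement \<open>d e\<close>, \<open>|e| = 1\<close>, decreases with slope at
  least \<open>m d\<close> along \<open>e\<close>, so its sublevel sets are thin in that direction; if the displacement is mostly
  vertical, the difference is bounded below because \<open>f\<close> is Lipschitz. This is transversality.

  For the lower bounds on Favard length, restrict \<open>\<mu>\<close> to a small ball and let \<open>w (\<alpha>, \<beta>)\<close> be the mass of
  the points whose projection at \<open>\<alpha>\<close> is within \<open>r\<close> of \<open>\<beta>\<close>. The function \<open>w\<close> vanishes outside the set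
  measured by the Favard length of the \<open>r\<close>-neighbourhood, so by Cauchy--Schwarz that length is at
  least \<open>(\<integral>w)\<^sup>2 / \<integral>w\<^sup>2\<close>. Transversality bounds \<open>\<integral>w\<^sup>2\<close> by \<open>r\<close> times the energy of the
  kernel \<open>min 1 (r / |p - q|)\<close>, which a dyadic decomposition bounds by a multiple of \<open>r\<^sup>t\<close>
  or of \<open>r log (1/r)\<close>.
\<close>

section \<open>Transversality\<close>

text \<open>Convexity and evenness make \<open>F\<close> nondecreasing on the nonnegative half of
  the interval, because 0 \<le> x \<le> y puts x between -y and y. A nondecreasing convex function
  of the norm is convex by the triangle inequality.\<close>

lemma convex_on_even_comp_norm:
  fixes F :: "real \<Rightarrow> real"
  assumes F: "convex_on {-L<..<L} F" and even: "\<And>x. x \<in> {-L<..<L} \<Longrightarrow> F (- x) = F x"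
  shows "convex_on (ball 0 L) (\<lambda>u::'a::real_normed_vector. F (norm u))"
proof
  have mono: "F x \<le> F y" if "0 \<le> x" "x \<le> y" "y < L" for x y
  proof (cases "y = 0")
    case False
    \<comment> \<open>The weight that writes x as a convex combination of -y and y, where
      \<open>F\<close> takes equal values.\<close>
    define s where "s = (x + y) / (2 * y)"
    have s: "0 \<le> s" "s \<le> 1" "(1 - s) *\<^sub>R (- y) + s *\<^sub>R y = x"
      using that False by (auto simp: s_def field_simps)
    have "F ((1 - s) *\<^sub>R (- y) + s *\<^sub>R y) \<le> (1 - s) * F (- y) + s * F y"
      using that s by (intro convex_onD[OF F]) auto
    also have "\<dots> = F y"
      using that even[of y] by (simp add: algebra_simps)
    finally show ?thesis
      unfolding s(3) .
  qed (use that in simp)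
  fix s :: real and x y :: 'a
  assume s: "s > 0" "s < 1" and xy: "x \<in> ball 0 L" "y \<in> ball 0 L"
  have le: "norm ((1 - s) *\<^sub>R x + s *\<^sub>R y) \<le> (1 - s) * norm x + s * norm y"
    using s norm_triangle_ineq[of "(1 - s) *\<^sub>R x" "s *\<^sub>R y"] by simp
  have lt: "(1 - s) * norm x + s * norm y < L"
    using convex_bound_lt[of "norm x" L "norm y" "1 - s" s] s xy by simp
  have "F (norm ((1 - s) *\<^sub>R x + s *\<^sub>R y)) \<le> F ((1 - s) *\<^sub>R norm x + s *\<^sub>R norm y)"
    using le lt by (intro mono) auto
  also have "\<dots> \<le> (1 - s) * F (norm x) + s * F (norm y)"
  proof (intro convex_onD[OF F])
    have "norm x < L" "norm y < L" "0 \<le> norm x" "0 \<le> norm y"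
      using xy by auto
    then show "norm x \<in> {-L<..<L}" "norm y \<in> {-L<..<L}"
      unfolding greaterThanLessThan_iff by linarith+
  qed (use s in auto)
  finally show "F (norm ((1 - s) *\<^sub>R x + s *\<^sub>R y)) \<le> (1 - s) * F (norm x) + s * F (norm y)" .
qed simp

text \<open>The two inner points lie on the segment from p to p + (d + s) e with complementary
  weights, so adding the two convexity inequalities leaves just the sum of the end values. In the
  quadratic part the terms with p \<bullet> e cancel, and (d + s)^2 - d^2 - s^2 = 2 d s yields the
  gain m d s.\<close>

lemma strongly_convex_parallelogram:
  fixes g :: "'a::real_inner \<Rightarrow> real"
  assumes conv: "convex_on D (\<lambda>u. g u - m / 2 * (norm u)\<^sup>2)"
    and e: "norm e = 1" and d: "0 \<le> d" and s: "0 \<le> s"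
    and p: "p \<in> D" "p + (d + s) *\<^sub>R e \<in> D"
  shows "g (p + d *\<^sub>R e) + g (p + s *\<^sub>R e) + m * d * s \<le> g p + g (p + (d + s) *\<^sub>R e)"
proof (cases "d + s = 0")
  case True
  then have "d = 0" "s = 0"
    using d s by auto
  then show ?thesis
    by simp
next
  case False
  let ?G = "\<lambda>u. g u - m / 2 * (norm u)\<^sup>2"
  let ?q = "p + (d + s) *\<^sub>R e"
  define l where "l = d / (d + s)"
  have l: "0 \<le> l" "l \<le> 1" "l * (d + s) = d"
    using d s False by (auto simp: l_def field_simps)
  have l': "(1 - l) * (d + s) = s"
    using l(3) by (simp add: algebra_simps)
  have eq1: "(1 - l) *\<^sub>R p + l *\<^sub>R ?q = p + d *\<^sub>R e"
    using l(3) by (simp add: scaleR_right_distrib scaleR_left_diff_distrib)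
  have eq2: "l *\<^sub>R p + (1 - l) *\<^sub>R ?q = p + s *\<^sub>R e"
    using l' by (simp add: scaleR_right_distrib scaleR_left_diff_distrib)
  have 1: "?G (p + d *\<^sub>R e) \<le> (1 - l) * ?G p + l * ?G ?q"
    using convex_onD[OF conv l(1,2) p] unfolding eq1 .
  have 2: "?G (p + s *\<^sub>R e) \<le> l * ?G p + (1 - l) * ?G ?q"
    using convex_onD[OF conv _ _ p, of "1 - l"] l(1,2) eq2 by simp
  have quad: "(norm (p + x *\<^sub>R e))\<^sup>2 = (norm p)\<^sup>2 + 2 * x * (p \<bullet> e) + x\<^sup>2" for x
    using e unfolding power2_norm_eq_inner norm_eq_1
    by (simp add: inner_left_distrib inner_right_distrib inner_commute power2_eq_square algebra_simps)
  have "?G (p + d *\<^sub>R e) + ?G (p + s *\<^sub>R e) \<le> ?G p + ?G ?q"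
  proof -
    have "(1 - l) * A + l * B + (l * A + (1 - l) * B) = A + B" for A B :: real
      by (simp add: algebra_simps)
    from this[of "?G p" "?G ?q"] 1 2 show ?thesis
      by linarith
  qed
  then show ?thesis
    unfolding quad by (simp add: power2_eq_square algebra_simps)
qed

text \<open>The translates of \<open>S\<close> by \<open>0, \<eta>, 2\<eta>, \<dots>\<close> along \<open>e\<close> are pairwise disjoint,
  and about \<open>R / \<eta>\<close> of them fit into a ball of twice the radius.\<close>
lemma measure_thin_in_direction:
  fixes S :: "'a::euclidean_space set"
  assumes S: "S \<in> lmeasurable" "S \<subseteq> cball z R" and e: "norm e = 1"
    and pos: "0 < \<eta>" "0 < R"
    and thin: "\<And>x s. x \<in> S \<Longrightarrow> \<eta> \<le> s \<Longrightarrow> x + s *\<^sub>R e \<notin> S"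
  shows "measure lebesgue S \<le> 2 * measure lebesgue (cball z (2 * R)) / R * \<eta>"
proof -
  let ?V = "measure lebesgue (cball z (2 * R))"
  show ?thesis
  proof (cases "\<eta> \<le> R")
    \<comment> \<open>If \<eta> exceeds R, the volume of the large ball is already below the claimed
      bound.\<close>
    case False
    have "measure lebesgue S \<le> ?V"
      using S pos by (intro measure_mono_fmeasurable) auto
    also have "?V * 1 \<le> ?V * (2 / R * \<eta>)"
      using False pos by (intro mult_left_mono) (auto simp: field_simps)
    finally show ?thesis
      by (simp add: ac_simps)
  next
    case True
    \<comment> \<open>Rounding down keeps every shift at most R, so the translates stay in the ball
      of radius 2 R. Since R / \<eta> is at least 1, it costs at most a factor 2.\<close>
    define N where "N = nat \<lfloor>R / \<eta>\<rfloor>"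
    have "1 \<le> R / \<eta>"
      using True pos by simp
    then have N: "real N \<le> R / \<eta>" "R / \<eta> < real N + 1"
      "1 \<le> real N"
      unfolding N_def by linarith+ (use \<open>1 \<le> R / \<eta>\<close> in \<open>simp add: le_nat_floor\<close>)
    have "R / \<eta> \<le> 2 * real N"
      using N by linarith
    then have R: "R \<le> 2 * real N * \<eta>" and NR: "real N * \<eta> \<le> R"
      using N(1) pos by (auto simp: field_simps)
    define T where "T k = (+) ((real k * \<eta>) *\<^sub>R e) ` S" for k
    have T: "T k \<in> lmeasurable" "measure lebesgue (T k) = measure lebesgue S" for k
      using S(1) unfolding T_def by (auto simp: measurable_translation measure_translation)
    have no_meet: False if "j < k" "x \<in> T j" "x \<in> T k" for j k x
    proof -
      from that(2,3) obtain u v where uv: "u \<in> S" "v \<in> S" "x = (real j * \<eta>) *\<^sub>R e + u" "x = (real k * \<eta>) *\<^sub>R e + v"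
        unfolding T_def by (elim imageE)
      have eq: "v + ((real k - real j) * \<eta>) *\<^sub>R e = u"
        using uv(3,4) by (simp add: algebra_simps)
      have "1 * \<eta> \<le> (real k - real j) * \<eta>"
        using that pos by (intro mult_right_mono) auto
      with thin[OF uv(2)] eq uv(1) show False
        by (metis mult_1)
    qed
    have disj: "disjoint_family_on T {..<N}"
      unfolding disjoint_family_on_def using no_meet by (metis disjoint_iff linorder_neqE_nat)
    have sub: "T k \<subseteq> cball z (2 * R)" if "k < N" for k
    proof
      fix x assume "x \<in> T k"
      then obtain u where u: "u \<in> S" "x = (real k * \<eta>) *\<^sub>R e + u"
        unfolding T_def by blast
      have "dist z x \<le> dist z u + dist u x"
        by (rule dist_triangle)
      also have "dist z u \<le> R"
        using u S by auto
      also have "dist u x = real k * \<eta>"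
        using u e pos by (simp add: dist_norm)
      also have "real k * \<eta> \<le> R"
        by (rule order_trans[OF mult_right_mono NR]) (use that pos in auto)
      finally show "x \<in> cball z (2 * R)"
        by simp
    qed
    have "real N * measure lebesgue S = (\<Sum>k<N. measure lebesgue (T k))"
      using T by simp
    also have "\<dots> = measure lebesgue (\<Union>k<N. T k)"
      using T disj by (intro measure_finite_Union[symmetric])
        (auto simp: fmeasurableD fmeasurableD2 simp del: emeasure_completion)
    also have "\<dots> \<le> ?V"
      using T sub by (intro measure_mono_fmeasurable) (auto simp: fmeasurableD)
    finally have NS: "real N * measure lebesgue S \<le> ?V" .
    have "R * measure lebesgue S \<le> (2 * real N * \<eta>) * measure lebesgue S"
      using R by (intro mult_right_mono) auto
    also have "\<dots> = 2 * \<eta> * (real N * measure lebesgue S)"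
      by simp
    also have "\<dots> \<le> 2 * \<eta> * ?V"
      using NS pos by (intro mult_left_mono) auto
    finally show ?thesis
      using pos by (simp add: field_simps)
  qed
qed

text \<open>The term 2 + 1 / B comes from displacements that are mainly vertical, the last term from
  the slope estimate. Adding the two avoids a maximum. The type argument fixes the dimension of the
  ball.\<close>

definition transversal_const :: "'a::euclidean_space itself \<Rightarrow> real \<Rightarrow> real \<Rightarrow> real \<Rightarrow> real" where
  "transversal_const _ m B R =
    measure lebesgue (cball (0::'a) (2 * R)) * (2 + 1 / B + 6 * (1 + 2 * B) / (m * R))"

text \<open>If the vertical distance dominates, the Lipschitz bound keeps the two projections apart.
  Otherwise, by strong convexity, their difference decreases with slope at least a multiple
  of \<open>norm (a - a')\<close> in the direction of \<open>fst a - fst a'\<close>.\<close>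
lemma graph_projection_transversal:
  fixes g :: "'a::euclidean_space \<Rightarrow> real" and a a' :: "'a \<times> real"
  assumes pos: "0 < m" "0 < B" "0 < R" "0 < \<delta>"
    and conv: "convex_on D (\<lambda>u. g u - m / 2 * (norm u)\<^sup>2)"
    and lip: "B-lipschitz_on D g"
    and D: "\<And>\<alpha>. \<alpha> \<in> cball z R \<Longrightarrow> \<alpha> - fst a \<in> D" "\<And>\<alpha>. \<alpha> \<in> cball z R \<Longrightarrow> \<alpha> - fst a' \<in> D"
    and ne: "a \<noteq> a'"
  defines "S \<equiv> {\<alpha> \<in> cball z R. \<bar>(snd a + g (\<alpha> - fst a)) - (snd a' + g (\<alpha> - fst a'))\<bar> \<le> \<delta>}"
  shows "S \<in> lmeasurable"
    and "measure lebesgue S \<le> transversal_const TYPE('a) m B R * (\<delta> / norm (a - a'))"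
proof -
  define h where "h \<alpha> = (snd a + g (\<alpha> - fst a)) - (snd a' + g (\<alpha> - fst a'))" for \<alpha>
  have "continuous_on D g"
    using lip by (rule lipschitz_on_continuous_on)
  then have g: "continuous_on (cball z R) (\<lambda>\<alpha>. g (\<alpha> - x))" if "\<And>\<alpha>. \<alpha> \<in> cball z R \<Longrightarrow> \<alpha> - x \<in> D" for x
    using that by (rule_tac continuous_on_compose2[of D g]) (auto intro!: continuous_intros)
  have h: "continuous_on (cball z R) h"
    unfolding h_def by (intro continuous_intros g D)
  have S_eq: "S = cball z R \<inter> h -` {-\<delta>..\<delta>}"
    unfolding S_def h_def by auto
  have "compact S"
    unfolding S_eq using continuous_on_closed_vimage[of "cball z R" h] h
    by (metis Int_commute closed_cball closed_atLeastAtMost compact_Int_closed compact_cball inf.right_idem)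
  then show S: "S \<in> lmeasurable"
    by (rule lmeasurable_compact)
  let ?V = "measure lebesgue (cball (0::'a) (2 * R))"
  have V: "measure lebesgue (cball z (2 * R)) = ?V"
    using measure_translation[of z "cball 0 (2 * R)"] by (simp add: cball_translation[symmetric])
  define d where "d = norm (fst a - fst a')"
  define v where "v = \<bar>snd a - snd a'\<bar>"
  define n where "n = norm (a - a')"
  have "0 < n"
    using ne by (simp add: n_def)
  moreover have "n \<le> d + v"
    using sqrt_sum_squares_le_sum_abs[of d v] by (simp add: n_def d_def v_def norm_prod_def)
  ultimately have n: "0 < n" "n \<le> d + v" .
  have dv: "0 \<le> d" "0 \<le> v"
    by (auto simp: d_def v_def)
  have "measure lebesgue S \<le> ?V * (2 + 1 / B) * (\<delta> / n) \<or>
    measure lebesgue S \<le> ?V * (6 * (1 + 2 * B) / (m * R)) * (\<delta> / n)"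
  \<comment> \<open>With this threshold the Lipschitz bound B d uses up at most half of v, so a
    nonempty \<open>S\<close> forces v \<le> 2 \<delta>.\<close>
  proof (cases "2 * B * d \<le> v")
    case True
    have "measure lebesgue S \<le> ?V * (2 + 1 / B) * (\<delta> / n)"
    proof (cases "S = {}")
      case True
      then show ?thesis
        using pos n by simp
    next
      case False
      then obtain \<alpha> where \<alpha>: "\<alpha> \<in> cball z R" "\<bar>h \<alpha>\<bar> \<le> \<delta>"
        unfolding S_def h_def by blast
      have "\<bar>g (\<alpha> - fst a) - g (\<alpha> - fst a')\<bar> \<le> B * d"
        using lipschitz_onD[OF lip D[OF \<alpha>(1)]]
        by (simp add: dist_norm d_def norm_minus_commute)
      then have "v \<le> B * d + \<delta>"
        using \<alpha>(2) unfolding h_def v_def by linarith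
      then have v: "v \<le> 2 * \<delta>"
        using True by linarith
      have "d \<le> \<delta> / B"
        using True v pos by (simp add: field_simps)
      then have "n \<le> (2 + 1 / B) * \<delta>"
        using n v by (simp add: algebra_simps)
      then have 1: "1 \<le> (2 + 1 / B) * (\<delta> / n)"
        using n by (simp add: field_simps)
      have "measure lebesgue S \<le> measure lebesgue (cball z (2 * R))"
        using S pos by (intro measure_mono_fmeasurable) (auto simp: S_def fmeasurableD)
      also have "\<dots> \<le> ?V * ((2 + 1 / B) * (\<delta> / n))"
        unfolding V using mult_left_mono[OF 1, of ?V] by simp
      finally show ?thesis
        by (simp add: mult.assoc)
    qed
    then show ?thesis ..
  next
    case False
    then have "d > 0"
      using dv by (cases "d = 0") auto
    define e where "e = (fst a - fst a') /\<^sub>R d"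
    have e: "norm e = 1" "fst a = fst a' + d *\<^sub>R e"
      using \<open>d > 0\<close> by (auto simp: e_def d_def)
    \<comment> \<open>A shift by \<eta> lowers \<open>h\<close> by at least 3 \<delta>, whereas two
      values of modulus at most \<delta> differ by at most 2 \<delta>.\<close>
    define \<eta> where "\<eta> = 3 * \<delta> / (m * d)"
    have "measure lebesgue S \<le> 2 * measure lebesgue (cball z (2 * R)) / R * \<eta>"
    proof (rule measure_thin_in_direction)
      fix x s assume x: "x \<in> S" and s: "\<eta> \<le> s"
      show "x + s *\<^sub>R e \<notin> S"
      proof
        assume xs: "x + s *\<^sub>R e \<in> S"
        have "0 < \<eta>"
          unfolding \<eta>_def using pos \<open>d > 0\<close> by simp
        have "x \<in> cball z R" "x + s *\<^sub>R e \<in> cball z R"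
          using x xs by (auto simp: S_def)
        then have "x - fst a \<in> D" "x + s *\<^sub>R e - fst a' \<in> D"
          using D by blast+
        \<comment> \<open>Shifting by d along e replaces \<open>fst a\<close> by
          \<open>fst a'\<close>. The four points of the parallelogram inequality based at
          \<open>x - fst a\<close> are thus the arguments of \<open>g\<close> in \<open>h x\<close>
          and \<open>h (x + s *\<^sub>R e)\<close>.\<close>
        moreover have "x - fst a + (d + s) *\<^sub>R e = x + s *\<^sub>R e - fst a'"
          by (simp add: e(2) algebra_simps)
        ultimately have "x - fst a \<in> D" "x - fst a + (d + s) *\<^sub>R e \<in> D"
          by (simp_all only:)
        then have "g (x - fst a + d *\<^sub>R e) + g (x - fst a + s *\<^sub>R e) + m * d * s
            \<le> g (x - fst a) + g (x - fst a + (d + s) *\<^sub>R e)"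
          using s \<open>0 < \<eta>\<close> \<open>d > 0\<close> by (intro strongly_convex_parallelogram[OF conv e(1)]) auto
        moreover have "x - fst a + d *\<^sub>R e = x - fst a'" "x - fst a + s *\<^sub>R e = x + s *\<^sub>R e - fst a"
          "x - fst a + (d + s) *\<^sub>R e = x + s *\<^sub>R e - fst a'"
          by (auto simp: e(2) algebra_simps)
        ultimately have "h (x + s *\<^sub>R e) \<le> h x - m * d * s"
          unfolding h_def by simp
        moreover have "3 * \<delta> \<le> m * d * s"
          using s pos \<open>d > 0\<close> by (simp add: \<eta>_def field_simps)
        moreover have "\<bar>h x\<bar> \<le> \<delta>" "\<bar>h (x + s *\<^sub>R e)\<bar> \<le> \<delta>"
          using x xs unfolding S_def h_def by auto
        ultimately show False
          using pos by linarith
      qed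
    qed (use S e pos \<open>d > 0\<close> in \<open>auto simp: \<eta>_def S_def\<close>)
    also have "\<dots> = ?V * (6 / (m * R)) * (\<delta> * (1 / d))"
      unfolding V by (simp add: \<eta>_def field_simps)
    also have "\<dots> \<le> ?V * (6 / (m * R)) * (\<delta> * ((1 + 2 * B) / n))"
    proof -
      have "n \<le> d * (1 + 2 * B)"
        using False n by (simp add: algebra_simps)
      then have "1 / d \<le> (1 + 2 * B) / n"
        using n \<open>d > 0\<close> by (simp add: field_simps)
      then show ?thesis
        using pos by (intro mult_left_mono) auto
    qed
    finally show ?thesis
      by (simp add: field_simps)
  qed
  moreover have "0 \<le> ?V * (2 + 1 / B) * (\<delta> / n)" "0 \<le> ?V * (6 * (1 + 2 * B) / (m * R)) * (\<delta> / n)"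
    using pos n by auto
  ultimately have "measure lebesgue S \<le>
      ?V * (2 + 1 / B) * (\<delta> / n) + ?V * (6 * (1 + 2 * B) / (m * R)) * (\<delta> / n)"
    by linarith
  then show "measure lebesgue S \<le> transversal_const TYPE('a) m B R * (\<delta> / norm (a - a'))"
    by (simp add: transversal_const_def n_def algebra_simps)
qed

section \<open>The energy method\<close>

lemma borel_strip:
  fixes u :: "'a::second_countable_topology \<Rightarrow> real"
  assumes [measurable]: "u \<in> borel_measurable borel" "B \<in> sets borel"
  shows "{x. fst x \<in> B \<and> \<bar>snd x - u (fst x)\<bar> < r} \<in> sets borel"
proof -
  have "{x \<in> space (borel \<Otimes>\<^sub>M borel). fst x \<in> B \<and> \<bar>snd x - u (fst x)\<bar> < r} \<in> sets (borel \<Otimes>\<^sub>M borel)"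
    by measurable
  then show ?thesis
    unfolding borel_prod by simp
qed

lemma emeasure_strip:
  fixes u :: "'a::euclidean_space \<Rightarrow> real"
  assumes u: "u \<in> borel_measurable borel" and B[measurable]: "B \<in> sets borel" and r: "0 \<le> r"
  shows "emeasure lborel {x. fst x \<in> B \<and> \<bar>snd x - u (fst x)\<bar> < r} = ennreal (2 * r) * emeasure lborel B"
proof -
  let ?S = "{x. fst x \<in> B \<and> \<bar>snd x - u (fst x)\<bar> < r}"
  have S: "?S \<in> sets (lborel \<Otimes>\<^sub>M lborel)"
    unfolding lborel_prod sets_lborel by (intro borel_strip u B)
  have "Pair \<alpha> -` ?S = (if \<alpha> \<in> B then {u \<alpha> - r<..<u \<alpha> + r} else {})" for \<alpha>
    by auto
  then have slice: "emeasure lborel (Pair \<alpha> -` ?S) = ennreal (2 * r) * indicator B \<alpha>" for \<alpha>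
    using r by simp
  have "emeasure lborel ?S = emeasure (lborel \<Otimes>\<^sub>M lborel) ?S"
    unfolding lborel_prod ..
  also have "\<dots> = (\<integral>\<^sup>+\<alpha>. ennreal (2 * r) * indicator B \<alpha> \<partial>lborel)"
    unfolding lborel.emeasure_pair_measure_alt[OF S] slice ..
  also have "\<dots> = ennreal (2 * r) * emeasure lborel B"
    by (simp add: nn_integral_cmult)
  finally show ?thesis .
qed

text \<open>Cauchy--Schwarz for the function counting, with respect to \<open>\<mu>\<close>, the graphs that pass within
  vertical distance \<open>r\<close> of a point.\<close>
lemma energy_lower_bound:
  fixes A :: "'a::euclidean_space set" and \<mu> :: "'p::second_countable_topology measure"
    and h :: "'a \<Rightarrow> 'p \<Rightarrow> real"
  assumes "finite_measure \<mu>" and sets_\<mu>[measurable_cong]: "sets \<mu> = sets borel"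
    and [measurable]: "(\<lambda>(\<alpha>, p). h \<alpha> p) \<in> borel_measurable (borel \<Otimes>\<^sub>M borel)"
    and A[measurable]: "A \<in> sets borel" and [measurable]: "Q \<in> sets borel"
    and G_borel: "G \<in> sets borel" and r: "0 \<le> r"
    and G: "\<And>\<alpha> \<beta> p. \<alpha> \<in> A \<Longrightarrow> p \<in> Q \<Longrightarrow> \<bar>\<beta> - h \<alpha> p\<bar> < r \<Longrightarrow> (\<alpha>, \<beta>) \<in> G"
    and energy: "\<And>p. p \<in> Q \<Longrightarrow>
      (\<integral>\<^sup>+q. emeasure lborel {\<alpha> \<in> A. \<bar>h \<alpha> p - h \<alpha> q\<bar> \<le> 2 * r} * indicator Q q \<partial>\<mu>) \<le> J"
  shows "(ennreal (2 * r) * emeasure lborel A * emeasure \<mu> Q)\<^sup>2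
    \<le> emeasure lborel G * (ennreal (2 * r) * J * emeasure \<mu> Q)"
proof -
  interpret finite_measure \<mu> by fact
  interpret P: pair_sigma_finite "lborel :: ('a \<times> real) measure" \<mu> ..
  have G'[measurable]: "G \<in> sets (borel \<Otimes>\<^sub>M borel)"
    using G_borel unfolding borel_prod .
  have lb[measurable_cong]: "sets (lborel :: ('a \<times> real) measure) = sets (borel \<Otimes>\<^sub>M borel)"
    by (simp only: borel_prod sets_lborel)
  have hp: "(\<lambda>\<alpha>. h \<alpha> p) \<in> borel_measurable borel" for p
    by measurable
  define W :: "'a \<times> real \<Rightarrow> 'p \<Rightarrow> ennreal" where
    "W x p = (if fst x \<in> A \<and> p \<in> Q \<and> \<bar>snd x - h (fst x) p\<bar> < r then 1 else 0)" for x p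
  have W[measurable]: "(\<lambda>(x, p). W x p) \<in> borel_measurable (lborel \<Otimes>\<^sub>M \<mu>)"
    unfolding W_def by measurable
  have [measurable]: "(\<lambda>x. W x p) \<in> borel_measurable lborel" "(\<lambda>p. W x p) \<in> borel_measurable \<mu>" for x p
    unfolding W_def by measurable
  define w where "w x = (\<integral>\<^sup>+p. W x p \<partial>\<mu>)" for x
  have w[measurable]: "w \<in> borel_measurable lborel"
    unfolding w_def by measurable
  have "(\<integral>\<^sup>+x. w x \<partial>lborel) = (\<integral>\<^sup>+p. \<integral>\<^sup>+x. W x p \<partial>lborel \<partial>\<mu>)"
    unfolding w_def by (intro P.Fubini'[symmetric] W)
  also have "\<dots> = (\<integral>\<^sup>+p. ennreal (2 * r) * emeasure lborel A * indicator Q p \<partial>\<mu>)"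
  proof (intro nn_integral_cong)
    fix p
    have "(\<integral>\<^sup>+x. W x p \<partial>lborel)
        = (\<integral>\<^sup>+x. indicator Q p * indicator {x. fst x \<in> A \<and> \<bar>snd x - h (fst x) p\<bar> < r} x \<partial>lborel)"
      by (intro nn_integral_cong) (auto simp: W_def indicator_def)
    also have "\<dots> = indicator Q p * emeasure lborel {x. fst x \<in> A \<and> \<bar>snd x - h (fst x) p\<bar> < r}"
      by (intro nn_integral_cmult_indicator) (use borel_strip[OF hp A] in simp)
    also have "\<dots> = indicator Q p * (ennreal (2 * r) * emeasure lborel A)"
      using r by (subst emeasure_strip[OF hp A]) auto
    finally show "(\<integral>\<^sup>+x. W x p \<partial>lborel) = ennreal (2 * r) * emeasure lborel A * indicator Q p"
      by (simp add: mult.commute)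
  qed
  also have "\<dots> = ennreal (2 * r) * emeasure lborel A * emeasure \<mu> Q"
    by (intro nn_integral_cmult_indicator) measurable
  finally have int_w: "(\<integral>\<^sup>+x. w x \<partial>lborel) = ennreal (2 * r) * emeasure lborel A * emeasure \<mu> Q" .

  \<comment> \<open>If \<beta> is within r of both heights, these differ by less than 2 r. Hence the
    product lives on a strip of vertical width 2 r over the set of such \<alpha>, which is where the
    2 r in the energy hypothesis comes from.\<close>
  have overlap: "(\<integral>\<^sup>+x. W x p * W x q \<partial>lborel) \<le>
      ennreal (2 * r) * indicator Q p * (emeasure lborel {\<alpha> \<in> A. \<bar>h \<alpha> p - h \<alpha> q\<bar> \<le> 2 * r} * indicator Q q)"
    for p q
  proof (cases "p \<in> Q \<and> q \<in> Q")
    case True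
    let ?B = "{\<alpha> \<in> A. \<bar>h \<alpha> p - h \<alpha> q\<bar> \<le> 2 * r}"
    let ?S = "{x. fst x \<in> ?B \<and> \<bar>snd x - h (fst x) p\<bar> < r}"
    have B: "?B \<in> sets borel"
      by measurable
    have "(\<integral>\<^sup>+x. W x p * W x q \<partial>lborel) \<le> (\<integral>\<^sup>+x. indicator ?S x \<partial>lborel)"
      by (intro nn_integral_mono) (auto simp: W_def indicator_def)
    also have "\<dots> = emeasure lborel ?S"
      using B by (intro nn_integral_indicator) (use borel_strip[OF hp B] in simp)
    also have "\<dots> = ennreal (2 * r) * emeasure lborel ?B"
      using r B by (intro emeasure_strip hp)
    finally show ?thesis
      using True by simp
  qed (auto simp: W_def)
  \<comment> \<open>The square is expanded into a double integral over pairs (p, q), and two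
    applications of Tonelli bring the integral over x inside.\<close>
  have "(\<integral>\<^sup>+x. (w x)\<^sup>2 \<partial>lborel) = (\<integral>\<^sup>+x. \<integral>\<^sup>+p. W x p * w x \<partial>\<mu> \<partial>lborel)"
  proof (intro nn_integral_cong)
    fix x
    have "(\<integral>\<^sup>+p. W x p * w x \<partial>\<mu>) = (\<integral>\<^sup>+p. W x p \<partial>\<mu>) * w x"
      by (intro nn_integral_multc) measurable
    then show "(w x)\<^sup>2 = (\<integral>\<^sup>+p. W x p * w x \<partial>\<mu>)"
      by (simp add: w_def power2_eq_square)
  qed
  also have "\<dots> = (\<integral>\<^sup>+p. \<integral>\<^sup>+x. W x p * w x \<partial>lborel \<partial>\<mu>)"
    by (intro P.Fubini'[symmetric]) measurable
  also have "\<dots> = (\<integral>\<^sup>+p. \<integral>\<^sup>+q. \<integral>\<^sup>+x. W x p * W x q \<partial>lborel \<partial>\<mu> \<partial>\<mu>)"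
  proof (intro nn_integral_cong)
    fix p
    have "(\<integral>\<^sup>+x. W x p * w x \<partial>lborel) = (\<integral>\<^sup>+x. \<integral>\<^sup>+q. W x p * W x q \<partial>\<mu> \<partial>lborel)"
      unfolding w_def by (intro nn_integral_cong nn_integral_cmult[symmetric]) measurable
    also have "\<dots> = (\<integral>\<^sup>+q. \<integral>\<^sup>+x. W x p * W x q \<partial>lborel \<partial>\<mu>)"
      by (intro P.Fubini'[symmetric]) measurable
    finally show "(\<integral>\<^sup>+x. W x p * w x \<partial>lborel) = (\<integral>\<^sup>+q. \<integral>\<^sup>+x. W x p * W x q \<partial>lborel \<partial>\<mu>)" .
  qed
  also have "\<dots> \<le> (\<integral>\<^sup>+p. ennreal (2 * r) * J * indicator Q p \<partial>\<mu>)"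
  proof (intro nn_integral_mono)
    fix p
    let ?e = "\<lambda>q. emeasure lborel {\<alpha> \<in> A. \<bar>h \<alpha> p - h \<alpha> q\<bar> \<le> 2 * r} * indicator Q q"
    have "(\<integral>\<^sup>+q. \<integral>\<^sup>+x. W x p * W x q \<partial>lborel \<partial>\<mu>) \<le> (\<integral>\<^sup>+q. ennreal (2 * r) * indicator Q p * ?e q \<partial>\<mu>)"
      by (intro nn_integral_mono overlap)
    also have "\<dots> = ennreal (2 * r) * indicator Q p * (\<integral>\<^sup>+q. ?e q \<partial>\<mu>)"
      by (intro nn_integral_cmult) measurable
    also have "\<dots> \<le> ennreal (2 * r) * J * indicator Q p"
      using energy[of p] by (cases "p \<in> Q") (auto intro: mult_left_mono)
    finally show "(\<integral>\<^sup>+q. \<integral>\<^sup>+x. W x p * W x q \<partial>lborel \<partial>\<mu>) \<le> ennreal (2 * r) * J * indicator Q p" .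
  qed
  also have "\<dots> = ennreal (2 * r) * J * emeasure \<mu> Q"
    by (intro nn_integral_cmult_indicator) measurable
  finally have int_w2: "(\<integral>\<^sup>+x. (w x)\<^sup>2 \<partial>lborel) \<le> ennreal (2 * r) * J * emeasure \<mu> Q" .

  \<comment> \<open>Inserting the indicator of \<open>G\<close> changes nothing, and Cauchy--Schwarz
    then makes the measure of \<open>G\<close> appear as the second factor.\<close>
  have supp: "w x * indicator G x = w x" for x
  proof (cases "x \<in> G")
    case False
    then have "W x p = 0" for p
      using G[of "fst x" p "snd x"] by (auto simp: W_def)
    then show ?thesis
      by (simp add: w_def)
  qed simp
  have "(\<integral>\<^sup>+x. w x \<partial>lborel)\<^sup>2 = (\<integral>\<^sup>+x. w x * indicator G x \<partial>lborel)\<^sup>2"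
    by (simp only: supp)
  also have "\<dots> \<le> (\<integral>\<^sup>+x. (w x)\<^sup>2 \<partial>lborel) * (\<integral>\<^sup>+x. (indicator G x)\<^sup>2 \<partial>lborel)"
    by (intro Cauchy_Schwarz_nn_integral) measurable
  also have "(\<integral>\<^sup>+x. (indicator G x :: ennreal)\<^sup>2 \<partial>lborel) = (\<integral>\<^sup>+x. indicator G x \<partial>lborel)"
    by (intro nn_integral_cong) (auto simp: indicator_def)
  also have "\<dots> = emeasure lborel G"
    using G_borel by (intro nn_integral_indicator) simp
  also have "(\<integral>\<^sup>+x. (w x)\<^sup>2 \<partial>lborel) * emeasure lborel G \<le> (ennreal (2 * r) * J * emeasure \<mu> Q) * emeasure lborel G"
    by (intro mult_right_mono int_w2) simp
  finally show ?thesis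
    unfolding int_w by (simp add: mult.commute)
qed

section \<open>Dyadic estimates of the energy\<close>

text \<open>An upper bound for the \<mu>-integral of min 1 (r / |p - q|) over q: the ball of radius
  2^k r has mass at most b (2^k r)^t and carries weight 2 (1/2)^k, and beyond radius 2^K r the
  kernel is at most (1/2)^K. The cutoff K is left free because the two regimes of t need different
  choices.\<close>

definition dyadic_energy :: "real \<Rightarrow> real \<Rightarrow> nat \<Rightarrow> real \<Rightarrow> real" where
  "dyadic_energy b t K r = 2 * b * (\<Sum>k\<le>K. (1/2)^k * (2^k * r) powr t) + (1/2)^K"

text \<open>Let j be least with d < 2^j r. If j = 0, use v \<le> 1. Otherwise d \<ge> 2^(j-1) r, so
  v is at most twice (1/2)^j, whence the factor 2. If d lies beyond the last scale, the tail term
  suffices.\<close>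

lemma le_dyadic_sum:
  fixes v d r :: real
  assumes v: "v \<le> 1" "v * d \<le> r" and r: "0 < r"
  shows "v \<le> 2 * (\<Sum>k\<le>K. (1/2)^k * indicator {..<2^k * r} d) + (1/2)^K"
proof (cases "d < 2^K * r")
  case False
  then have d: "2^K * r \<le> d" "0 < d"
    using r by (auto simp: not_less intro: less_le_trans[of 0 "2^K * r"])
  have "v \<le> (1/2)^K"
  proof (cases "0 \<le> v")
    case True
    then have "v * (2^K * r) \<le> r"
      using mult_left_mono[OF d(1) True] v(2) by linarith
    then have "(v * 2^K) * r \<le> 1 * r"
      by (simp add: mult.assoc)
    then show ?thesis
      using r by (simp add: power_divide field_simps)
  qed (simp add: order_trans[of v 0])
  then show ?thesis
    by (simp add: add_nonneg_nonneg sum_nonneg add.commute add_increasing2)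
next
  case True
  define j where "j = (LEAST j. d < 2^j * r)"
  have j: "d < 2^j * r" "j \<le> K"
    unfolding j_def using True by (auto intro: LeastI Least_le)
  have "v \<le> 2 * (1/2)^j"
  proof (cases j)
    case 0
    then show ?thesis
      using v by simp
  next
    case (Suc i)
    then have "\<not> d < 2^i * r"
      using not_less_Least[of i "\<lambda>j. d < 2^j * r"] unfolding j_def by simp
    then have d: "2^i * r \<le> d"
      by simp
    show ?thesis
    proof (cases "0 \<le> v")
      case True
      then have "v * (2^i * r) \<le> r"
        using mult_left_mono[OF d True] v(2) by linarith
      then have "(v * 2^i) * r \<le> 1 * r"
        by (simp add: mult.assoc)
      then show ?thesis
        using r Suc by (simp add: power_divide field_simps)
    qed (simp add: order_trans[of v 0])
  qed
  also have "(1/2)^j = (1/2)^j * (indicator {..<2^j * r} d :: real)"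
    using j by simp
  also have "\<dots> \<le> (\<Sum>k\<le>K. (1/2)^k * indicator {..<2^k * r} d)"
    using j by (intro member_le_sum) auto
  finally show ?thesis
    by (simp add: add_increasing2)
qed

text \<open>The pointwise dyadic bound is applied to \<phi> / C and integrated: indicators of balls
  become their measures, and the constant tail integrates to itself because \<mu> has mass one. Only
  the majorant \<open>?F\<close> has to be measurable.\<close>

lemma nn_integral_le_dyadic_energy:
  fixes \<mu> :: "'p::{metric_space, second_countable_topology} measure"
  assumes "prob_space \<mu>" and sets_\<mu>: "sets \<mu> = sets borel"
    and \<phi>: "\<And>q. \<phi> q \<le> C" "\<And>q. \<phi> q * dist p q \<le> C * r" and pos: "0 < C" "0 < r"
    and ball: "\<And>s. 0 < s \<Longrightarrow> measure \<mu> (ball p s) \<le> b * s powr t"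
  shows "(\<integral>\<^sup>+q. ennreal (\<phi> q) \<partial>\<mu>) \<le> ennreal (C * dyadic_energy b t K r)"
proof -
  interpret prob_space \<mu> by fact
  have [measurable]: "ball p s \<in> sets \<mu>" for s
    by (simp add: sets_\<mu>)
  define I :: "nat \<Rightarrow> 'p \<Rightarrow> real" where "I k = indicator (ball p (2^k * r))" for k
  have I: "integrable \<mu> (I k)" "(\<integral>q. I k q \<partial>\<mu>) = measure \<mu> (ball p (2^k * r))" "0 \<le> I k q" for k q
    by (auto simp: I_def emeasure_eq_measure intro!: integrable_real_indicator)
  let ?F = "\<lambda>q. C * (2 * (\<Sum>k\<le>K. (1/2)^k * I k q) + (1/2)^K)"
  have le: "\<phi> q \<le> ?F q" for q
  proof -
    have "\<phi> q / C \<le> 2 * (\<Sum>k\<le>K. (1/2)^k * indicator {..<2^k * r} (dist p q)) + (1/2)^K"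
      using \<phi>[of q] pos by (intro le_dyadic_sum) (auto simp: field_simps)
    also have "(\<Sum>k\<le>K. (1/2)^k * indicator {..<2^k * r} (dist p q)) = (\<Sum>k\<le>K. (1/2)^k * I k q)"
      by (intro sum.cong) (auto simp: I_def indicator_def)
    finally show ?thesis
      using pos by (simp add: pos_divide_le_eq mult.commute)
  qed
  have "(\<integral>\<^sup>+q. ennreal (\<phi> q) \<partial>\<mu>) \<le> (\<integral>\<^sup>+q. ennreal (?F q) \<partial>\<mu>)"
    by (intro nn_integral_mono ennreal_leI le)
  also have "\<dots> = ennreal (\<integral>q. ?F q \<partial>\<mu>)"
    using pos I by (intro nn_integral_eq_integral AE_I2) (auto intro!: mult_nonneg_nonneg add_nonneg_nonneg sum_nonneg)
  also have "(\<integral>q. ?F q \<partial>\<mu>) = C * (2 * (\<Sum>k\<le>K. (1/2)^k * measure \<mu> (ball p (2^k * r))) + (1/2)^K)"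
    using I by (simp add: prob_space)
  also have "\<dots> \<le> C * (2 * (\<Sum>k\<le>K. (1/2)^k * (b * (2^k * r) powr t)) + (1/2)^K)"
    using pos by (intro mult_left_mono add_mono sum_mono ball) auto
  also have "\<dots> = C * dyadic_energy b t K r"
    by (simp add: dyadic_energy_def sum_distrib_left algebra_simps)
  finally show ?thesis
    using pos by (simp add: ennreal_leI)
qed

lemma dyadic_energy_pos: "0 \<le> b \<Longrightarrow> 0 < dyadic_energy b t K r"
  unfolding dyadic_energy_def by (intro add_nonneg_pos mult_nonneg_nonneg sum_nonneg) auto

text \<open>The summands form r^t times a geometric progression of ratio 2^(t-1) < 1, so their sum
  is bounded uniformly in K, and K can be taken large enough for the tail to drop below r^t.\<close>

lemma dyadic_energy_subcritical:
  assumes "0 \<le> b" "t < 1" "0 < r"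
  shows "\<exists>K. dyadic_energy b t K r \<le> (2 * b / (1 - 2 powr (t - 1)) + 1) * r powr t"
proof -
  let ?x = "2 powr (t - 1) :: real"
  have x: "0 < ?x" "?x < 1"
    using assms powr_less_mono[of "t - 1" 0 2] by auto
  obtain K where K: "(1/2)^K < r powr t"
    using real_arch_pow_inv[of "r powr t" "1/2"] assms by auto
  have summand: "(1/2)^k * (2^k * r) powr t = r powr t * ?x ^ k" for k
    using assms by (simp add: powr_mult powr_diff power_divide powr_realpow[symmetric] powr_powr mult.commute)
  have "(\<Sum>k\<le>K. ?x ^ k) \<le> 1 / (1 - ?x)"
    using x sum_le_suminf[OF summable_geometric, of ?x "{..K}"] suminf_geometric[of ?x] by simp
  then have "dyadic_energy b t K r \<le> 2 * b * (r powr t * (1 / (1 - ?x))) + r powr t"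
    unfolding dyadic_energy_def summand sum_distrib_left[symmetric] using K assms
    by (intro add_mono mult_left_mono) auto
  also have "\<dots> = (2 * b / (1 - ?x) + 1) * r powr t"
    by (simp add: algebra_simps)
  finally show ?thesis ..
qed

text \<open>At t = 1 each of the K + 1 summands equals r, so K must stay comparable to log (1/r);
  this order of magnitude also makes the tail at most r.\<close>

lemma dyadic_energy_critical:
  assumes "0 \<le> b" "0 < r" "r \<le> 1 / 4"
  shows "\<exists>K. dyadic_energy b 1 K r \<le> (4 * b / ln 2 + 1) * (r * ln (inverse r))"
proof -
  let ?l = "log 2 (inverse r)"
  define K where "K = nat \<lceil>?l\<rceil>"
  \<comment> \<open>From r \<le> 1/4 the logarithm is at least 2, which absorbs both the rounding up
    and the extra summand: K + 1 \<le> 2 log2 (1/r).\<close>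
  have "log 2 (2 powr 2) \<le> ?l"
    using assms by (subst log_le_cancel_iff) (auto simp: field_simps)
  then have l: "2 \<le> ?l"
    by (simp only: log_powr_cancel)
  then have K: "?l \<le> real K" "real K + 1 \<le> 2 * ?l"
    unfolding K_def by linarith+
  have "inverse r = 2 powr ?l"
    using assms by simp
  also have "\<dots> \<le> 2 powr real K"
    using K by simp
  finally have "(1/2)^K \<le> r"
    using assms by (simp add: powr_realpow field_simps)
  moreover have "1 \<le> ln (inverse r)"
  proof -
    have "exp 1 \<le> inverse r"
    proof -
      have "4 \<le> inverse r"
        using assms by (simp add: field_simps)
      then show ?thesis
        using exp_le by linarith
    qed
    then show ?thesis
      using assms by (subst ln_ge_iff) auto
  qed
  then have "r * 1 \<le> r * ln (inverse r)"
    using assms by (intro mult_left_mono) auto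
  ultimately have tail: "(1/2)^K \<le> r * ln (inverse r)"
    by simp
  have "(\<Sum>k\<le>K. (1/2)^k * (2^k * r) powr 1) = (\<Sum>k\<le>K. r)"
    using assms by (intro sum.cong) (auto simp: power_divide)
  also have "\<dots> = r * (real K + 1)"
    by (simp add: algebra_simps)
  also have "\<dots> \<le> r * (2 * ?l)"
    using K assms by (intro mult_left_mono) auto
  finally have "dyadic_energy b 1 K r \<le> 2 * b * (r * (2 * ?l)) + r * ln (inverse r)"
    unfolding dyadic_energy_def using tail assms by (intro add_mono mult_left_mono) auto
  also have "\<dots> = (4 * b / ln 2 + 1) * (r * ln (inverse r))"
    by (simp add: log_def algebra_simps)
  finally show ?thesis ..
qed

section \<open>From energy to Favard length\<close>

lemma convex_on_eq_on:
  assumes "convex_on D F" "\<And>u. u \<in> D \<Longrightarrow> F u = G u"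
  shows "convex_on D G"
proof -
  have "convex D"
    using assms(1) by (simp add: convex_on_def)
  then have "u *\<^sub>R x + v *\<^sub>R y \<in> D" if "x \<in> D" "y \<in> D" "0 \<le> u" "0 \<le> v" "u + v = 1" for u v x y
    using that by (rule convexD)
  then show ?thesis
    using assms unfolding convex_on_def by metis
qed

text \<open>Finitely many balls of radius R cover E; if each met E in a null set, E would be null.
  This localizes \<mu> to a piece small enough for the graphs over it to share a common window of
  \<alpha>.\<close>

lemma exists_small_ball_pos_measure:
  fixes E :: "'p::heine_borel set"
  assumes "compact E" "sets \<mu> = sets borel" "emeasure \<mu> E \<noteq> 0" "0 < R"
  obtains x where "emeasure \<mu> (E \<inter> cball x R) \<noteq> 0"
proof (rule ccontr)
  assume no: "\<not> thesis"
  have E: "E \<in> sets borel"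
    using \<open>compact E\<close> by (simp add: compact_imp_closed)
  then have null: "E \<inter> cball x R \<in> null_sets \<mu>" for x
    using no that assms(2) by (auto simp: null_sets_def)
  obtain T where T: "finite T" "E \<subseteq> (\<Union>x\<in>T. ball x R)"
  proof (rule compactE_image[OF \<open>compact E\<close>, of UNIV "\<lambda>x. ball x R"])
    show "E \<subseteq> (\<Union>x\<in>UNIV. ball x R)"
      using \<open>0 < R\<close> by (intro subsetI UN_I[OF UNIV_I]) (rule centre_in_ball[THEN iffD2])
  qed auto
  have "(\<Union>x\<in>T. E \<inter> cball x R) \<in> null_sets \<mu>"
    using T(1) null by (intro null_sets.finite_UN) auto
  moreover have "E \<subseteq> (\<Union>x\<in>T. E \<inter> cball x R)"
    using T(2) by force
  ultimately have "E \<in> null_sets \<mu>"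
    using E assms(2) by (metis null_sets_subset)
  with assms(3) show False
    by auto
qed

text \<open>Combines the energy inequality, transversality and the dyadic bound on a small piece of
  E. The constant \<kappa> depends on neither r nor K, so K may be chosen afterwards in terms of
  r.\<close>

lemma Fav_thickening_lower_bound:
  fixes f :: "real \<Rightarrow> real" and E :: "((real^2) \<times> real) set"
  assumes pos: "0 < L" "0 < m" "0 < B"
    and cont: "continuous_on {0..L} f"
    and conv: "convex_on (ball 0 L) (\<lambda>u. gamma f u - m / 2 * (norm u)\<^sup>2)"
    and lip: "B-lipschitz_on (ball 0 L) (gamma f)"
    and E: "compact E" and \<mu>: "prob_space \<mu>" "sets \<mu> = sets borel" "emeasure \<mu> E = 1"
    and ball: "\<And>x r. x \<in> E \<Longrightarrow> 0 < r \<Longrightarrow> measure \<mu> (ball x r) \<le> b * r powr t" and b: "0 \<le> b"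
  shows "\<exists>\<kappa>>0. \<forall>r>0. \<forall>K. ennreal (\<kappa> * r / dyadic_energy b t K r) \<le> Fav (surface L f) (thickening E r)"
proof -
  interpret prob_space \<mu> by fact
  \<comment> \<open>With \<alpha> and \<open>fst p\<close> both within L / 3 of
    \<open>fst x0\<close>, their difference has norm at most 2 L / 3, inside the open disc where
    convexity and the Lipschitz bound hold.\<close>
  define R where "R = L / 3"
  have "0 < R"
    using pos by (simp add: R_def)
  obtain x0 where x0: "emeasure \<mu> (E \<inter> cball x0 R) \<noteq> 0"
    using exists_small_ball_pos_measure[OF E \<mu>(2) _ \<open>0 < R\<close>] \<mu>(3) by auto
  define Q where "Q = E \<inter> cball x0 R"
  define A where "A = cball (fst x0) R"
  define q where "q = measure \<mu> Q"
  define V where "V = measure lebesgue A"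
  have Q: "Q \<in> sets borel"
    using E by (auto simp: Q_def compact_imp_closed)
  have q: "emeasure \<mu> Q = ennreal q" "0 < q"
    using x0 by (auto simp: q_def Q_def emeasure_eq_measure zero_less_measure_iff)
  have A: "A \<in> sets borel" "A \<in> lmeasurable"
    by (auto simp: A_def)
  have lborel_eq: "emeasure lborel S = ennreal (measure lebesgue S)" if "S \<in> sets borel" "S \<in> lmeasurable"
    for S :: "(real^2) set"
    using that emeasure_eq_measure2[OF that(2)] by simp
  have V: "emeasure lborel A = ennreal V" "0 < V"
    using A \<open>0 < R\<close> content_cball_pos[of R "fst x0"] by (auto simp: lborel_eq V_def A_def)

  \<comment> \<open>\<open>f\<close> is arbitrary outside \<open>{-L..L}\<close>; freezing it there makes \<open>h\<close> globally measurable.\<close>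
  define g where "g u = f (min (norm u) L)" for u :: "real^2"
  define h where "h \<alpha> p = snd p + g (\<alpha> - fst p)" for \<alpha> and p :: "(real^2) \<times> real"
  have g_eq: "g u = gamma f u" if "u \<in> ball 0 L" for u
    using that by (simp add: g_def gamma_def)
  have "continuous_on UNIV g"
    unfolding g_def using pos
    by (intro continuous_on_compose2[OF cont, of UNIV "\<lambda>u. min (norm u) L"] continuous_on_min
        continuous_on_norm continuous_on_id continuous_on_const) auto
  then have "continuous_on UNIV (\<lambda>x. h (fst x) (snd x))"
    unfolding h_def by (intro continuous_on_add continuous_on_compose2[of UNIV g "UNIV" "\<lambda>x. fst x - fst (snd x)"]
        continuous_on_snd continuous_on_diff continuous_on_fst continuous_on_id) auto
  then have "(\<lambda>x. h (fst x) (snd x)) \<in> borel_measurable (borel \<Otimes>\<^sub>M borel)"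
    unfolding borel_prod by (rule borel_measurable_continuous_onI)
  then have h: "(\<lambda>(\<alpha>, p). h \<alpha> p) \<in> borel_measurable (borel \<Otimes>\<^sub>M borel)"
    by (simp add: case_prod_beta')
  have dom: "\<alpha> - fst p \<in> ball 0 L" if "\<alpha> \<in> A" "p \<in> Q" for \<alpha> p
  proof -
    have "dist \<alpha> (fst p) \<le> dist \<alpha> (fst x0) + dist (fst x0) (fst p)"
      by (rule dist_triangle)
    also have "\<dots> \<le> R + R"
      using that dist_fst_le[of x0 p] by (intro add_mono) (auto simp: A_def Q_def dist_commute)
    finally show ?thesis
      using pos unfolding mem_ball_0 dist_norm R_def by simp
  qed
  have g_conv: "convex_on (ball 0 L) (\<lambda>u. g u - m / 2 * (norm u)\<^sup>2)"
    using conv by (rule convex_on_eq_on) (simp add: g_eq)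
  have g_lip: "B-lipschitz_on (ball 0 L) g"
    using lip by (rule lipschitz_on_transform) (simp_all add: g_eq)

  \<comment> \<open>V is the trivial bound for \<phi>, and the second term is the transversality
    bound at \<delta> = 2 r; the absolute value spares a sign argument.\<close>
  define C where "C = V + 2 * \<bar>transversal_const TYPE(real^2) m B R\<bar>"
  have C: "0 < C"
    using V by (simp add: C_def)
  have energy: "(\<integral>\<^sup>+p'. emeasure lborel {\<alpha> \<in> A. \<bar>h \<alpha> p - h \<alpha> p'\<bar> \<le> 2 * r} * indicator Q p' \<partial>\<mu>)
      \<le> ennreal (C * dyadic_energy b t K r)" if p: "p \<in> Q" and r: "0 < r" for p r K
  proof -
    let ?S = "\<lambda>p'. {\<alpha> \<in> A. \<bar>h \<alpha> p - h \<alpha> p'\<bar> \<le> 2 * r}"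
    define \<phi> where "\<phi> p' = indicator Q p' * measure lebesgue (?S p')" for p'
    have h': "(\<lambda>\<alpha>. h \<alpha> p) \<in> borel_measurable borel" for p
      using measurable_compose[OF measurable_Pair2'[of p borel borel] h] by simp
    have S: "?S p' \<in> sets borel" for p'
      using A(1) borel_measurable_diff[OF h'[of p] h'[of p']] by measurable
    have S': "?S p' \<in> lmeasurable" for p'
      using S[of p'] by (intro fmeasurableI2[OF A(2)]) auto
    have le_V: "measure lebesgue (?S p') \<le> V" for p'
      unfolding V_def using S' A by (intro measure_mono_fmeasurable) (auto simp: fmeasurableD)
    have "(\<integral>\<^sup>+p'. emeasure lborel (?S p') * indicator Q p' \<partial>\<mu>) = (\<integral>\<^sup>+p'. ennreal (\<phi> p') \<partial>\<mu>)"
      by (intro nn_integral_cong) (auto simp: \<phi>_def lborel_eq[OF S S'] indicator_def)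
    also have "\<dots> \<le> ennreal (C * dyadic_energy b t K r)"
    proof (rule nn_integral_le_dyadic_energy[OF \<mu>(1,2) _ _ C r])
      fix p'
      show "\<phi> p' \<le> C"
        using le_V[of p'] V by (auto simp: \<phi>_def C_def indicator_def)
      show "\<phi> p' * dist p p' \<le> C * r"
      proof (cases "p' \<in> Q \<and> p' \<noteq> p")
        case True
        have "measure lebesgue (?S p') \<le> transversal_const TYPE(real^2) m B R * (2 * r / norm (p - p'))"
          unfolding h_def using True p r
          by (intro graph_projection_transversal(2)[OF pos(2,3) \<open>0 < R\<close> _ g_conv g_lip,
                of "2 * r" "fst x0", folded A_def] dom) auto
        then have "measure lebesgue (?S p') * norm (p - p')
            \<le> transversal_const TYPE(real^2) m B R * (2 * r / norm (p - p')) * norm (p - p')"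
          by (rule mult_right_mono) simp
        also have "\<dots> = (2 * transversal_const TYPE(real^2) m B R) * r"
          using True by auto
        also have "\<dots> \<le> C * r"
          using V r unfolding C_def by (intro mult_right_mono) auto
        finally show ?thesis
          using True by (simp add: \<phi>_def dist_norm)
      next
        case False
        then show ?thesis
          using C r by (auto simp: \<phi>_def)
      qed
    next
      show "measure \<mu> (ball p s) \<le> b * s powr t" if "0 < s" for s
        using ball[of p s] p that by (simp add: Q_def)
    qed
    finally show ?thesis .
  qed

  let ?G = "\<lambda>r. {(\<alpha>, \<beta>). \<beta> \<in> Phi_set (surface L f) \<alpha> (thickening E r)}"
  have "open (thickening E r)" for r
    unfolding thickening_def by (intro open_Collect_less continuous_intros)
  then have G: "?G r \<in> sets borel" for r
    by (simp add: open_Phi_set_graph)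
  \<comment> \<open>Cauchy--Schwarz gives (2 r V q)^2 \<le> F * 2 r C J q, with F the Favard length
    and J the dyadic energy; cancelling 2 r q leaves this quotient.\<close>
  have main: "ennreal (2 * V\<^sup>2 * q / C * r / dyadic_energy b t K r) \<le> Fav (surface L f) (thickening E r)"
    if r: "0 < r" for r K
  proof -
    let ?J = "dyadic_energy b t K r"
    have J: "0 < ?J"
      using b by (rule dyadic_energy_pos)
    have "(ennreal (2 * r) * emeasure lborel A * emeasure \<mu> Q)\<^sup>2
        \<le> emeasure lborel (?G r) * (ennreal (2 * r) * ennreal (C * ?J) * emeasure \<mu> Q)"
    proof (rule energy_lower_bound[OF finite_measure_axioms \<mu>(2) h A(1) Q G _ _ energy])
      fix \<alpha> \<beta> p assume *: "\<alpha> \<in> A" "p \<in> Q" "\<bar>\<beta> - h \<alpha> p\<bar> < r"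
      \<comment> \<open>Moving p vertically by the error makes its graph pass exactly through
        (\<alpha>, \<beta>), and p' is still closer than r to the point p of E.\<close>
      define p' where "p' = (fst p, snd p + (\<beta> - h \<alpha> p))"
      have "dist p' p < r"
        using * by (simp add: p'_def dist_prod_def dist_norm)
      then have "p' \<in> thickening E r"
        using * infdist_le[of p E p'] by (simp add: Q_def thickening_def)
      moreover have "\<beta> \<in> Phi (surface L f) \<alpha> p'"
        using dom[OF *(1,2)] by (simp add: Phi_surface Phi_pt_def p'_def h_def g_eq)
      ultimately show "(\<alpha>, \<beta>) \<in> ?G r"
        by (auto simp: Phi_set_def)
    qed (use r in auto)
    also have "emeasure lborel (?G r) = Fav (surface L f) (thickening E r)"
      using G[of r] by (simp add: Fav_def)
    finally have CS: "(ennreal (2 * r) * ennreal V * ennreal q)\<^sup>2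
        \<le> Fav (surface L f) (thickening E r) * (ennreal (2 * r) * ennreal (C * ?J) * ennreal q)"
      by (simp only: V(1) q(1))
    show ?thesis
    proof (cases "Fav (surface L f) (thickening E r)")
      case (real F)
      have "ennreal ((2 * r * V * q)\<^sup>2) \<le> ennreal (F * (2 * r * (C * ?J) * q))"
        using CS real r V q C J
        by (simp add: ennreal_mult[symmetric] ennreal_power)
      then have "(2 * r * V * q)\<^sup>2 \<le> F * (2 * r * (C * ?J) * q)"
        using real r q C J by (simp add: ennreal_le_iff)
      then have "(2 * r * q) * (2 * V\<^sup>2 * q * r) \<le> (2 * r * q) * (F * (C * ?J))"
        by (simp add: power2_eq_square algebra_simps)
      then have "2 * V\<^sup>2 * q * r \<le> F * (C * ?J)"
        using r q by (subst (asm) mult_le_cancel_left_pos) auto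
      then have "2 * V\<^sup>2 * q / C * r / ?J \<le> F"
        using C J by (simp add: field_simps)
      then show ?thesis
        by (simp add: real ennreal_leI)
    qed simp
  qed
  show ?thesis
    using main V q C by (intro exI[of _ "2 * V\<^sup>2 * q / C"]) auto
qed

section \<open>Rotation surfaces\<close>

text \<open>Subtracting m x^2 / 2 leaves an even function with second derivative at least 0. Passing
  to the open interval turns the one-sided endpoint derivatives into ordinary ones.\<close>

lemma strongly_convex_gamma:
  assumes "0 < L"
    and even: "\<And>x. x \<in> {-L..L} \<Longrightarrow> f (- x) = f x"
    and f': "\<And>x. x \<in> {-L..L} \<Longrightarrow> (f has_real_derivative f' x) (at x within {-L..L})"
    and f'': "\<And>x. x \<in> {-L..L} \<Longrightarrow> (f' has_real_derivative f'' x) (at x within {-L..L})"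
    and m: "\<And>x. x \<in> {-L..L} \<Longrightarrow> m \<le> f'' x"
  shows "convex_on (ball 0 L) (\<lambda>u. gamma f u - m / 2 * (norm u)\<^sup>2)"
proof -
  have interior: "at x within {-L..L} = at x" if "x \<in> {-L<..<L}" for x
    using that by (intro at_within_interior) simp
  have "convex_on {-L<..<L} (\<lambda>x. f x - m / 2 * x\<^sup>2)"
  proof (rule f''_ge0_imp_convex)
    fix x assume x: "x \<in> {-L<..<L}"
    have "(f has_real_derivative f' x) (at x)" "(f' has_real_derivative f'' x) (at x)"
      using f'[of x] f''[of x] x interior[OF x] by auto
    then show "((\<lambda>x. f x - m / 2 * x\<^sup>2) has_real_derivative f' x - m * x) (at x)"
      "((\<lambda>x. f' x - m * x) has_real_derivative f'' x - m) (at x)"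
      by (auto intro!: derivative_eq_intros)
    show "0 \<le> f'' x - m"
      using m[of x] x by simp
  qed simp
  then show ?thesis
    unfolding gamma_def using even by (intro convex_on_even_comp_norm) auto
qed

lemma lipschitz_on_gamma:
  assumes f': "\<And>x. x \<in> {-L..L} \<Longrightarrow> (f has_real_derivative f' x) (at x within {-L..L})"
    and B: "\<And>x. x \<in> {-L..L} \<Longrightarrow> \<bar>f' x\<bar> \<le> B" "0 \<le> B"
  shows "B-lipschitz_on (ball 0 L) (gamma f)"
proof (rule lipschitz_onI)
  fix u v :: "real^2"
  assume "u \<in> ball 0 L" "v \<in> ball 0 L"
  then have "norm u < L" "norm v < L" "0 \<le> norm u" "0 \<le> norm v"
    by auto
  then have uv: "norm u \<in> {-L..L}" "norm v \<in> {-L..L}"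
    unfolding atLeastAtMost_iff by linarith+
  have "norm (f (norm u) - f (norm v)) \<le> B * norm (norm u - norm v)"
    using B by (intro field_differentiable_bound[OF _ f' _ uv]) auto
  also have "\<dots> \<le> B * norm (u - v)"
    using B norm_triangle_ineq3[of u v] by (intro mult_left_mono) auto
  finally show "dist (gamma f u) (gamma f v) \<le> B * dist u v"
    by (simp add: gamma_def dist_norm)
qed (rule B)

theorem theorem1p10:
  fixes L t b :: real
    and f f' f'' :: "real \<Rightarrow> real"
    and E :: "((real^2) \<times> real) set"
    and \<mu> :: "((real^2) \<times> real) measure"
  assumes "L > 0"
    and "\<And>x. x \<in> {-L..L} \<Longrightarrow> f (- x) = f x"
    and "\<And>x. x \<in> {-L..L} \<Longrightarrow> (f has_real_derivative f' x) (at x within {-L..L})"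
    and "\<And>x. x \<in> {-L..L} \<Longrightarrow> (f' has_real_derivative f'' x) (at x within {-L..L})"
    and "continuous_on {-L..L} f''"
    and "\<And>x. x \<in> {-L..L} \<Longrightarrow> f'' x > 0"
    and "compact E"
    and "sets \<mu> = sets borel"
    and "prob_space \<mu>"
    and "emeasure \<mu> (- E) = 0"
    and "\<And>x r. x \<in> E \<Longrightarrow> 0 < r \<Longrightarrow> measure \<mu> (ball x r) \<le> b * r powr t"
  shows
    "(\<exists>c>0. \<exists>\<delta>\<^sub>0>0. \<forall>a\<in>cball 0 (L / 3). \<forall>a'\<in>cball 0 (L / 3). \<forall>\<delta>.
        a \<noteq> a' \<longrightarrow> 0 < \<delta> \<longrightarrow> \<delta> \<le> \<delta>\<^sub>0 \<longrightarrow>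
        emeasure lebesgue {\<alpha> \<in> cball 0 (L / 3). \<bar>Phi_pt f \<alpha> a - Phi_pt f \<alpha> a'\<bar> \<le> \<delta>}
          < ennreal (c * (\<delta> / norm (a - a')))) \<and>
     (t < 1 \<longrightarrow> (\<exists>c'>0. \<forall>\<^sub>F r in at_right 0.
        Fav (surface L f) (thickening E r) \<ge> ennreal (c' * r powr (1 - t)))) \<and>
     (t = 1 \<longrightarrow> (\<exists>c'>0. \<forall>\<^sub>F r in at_right 0.
        Fav (surface L f) (thickening E r) \<ge> ennreal (c' * inverse (ln (inverse r)))))"
proof -
  have ne: "{-L..L} \<noteq> {}"
    using \<open>L > 0\<close> by auto
  obtain m where m: "0 < m" "\<And>x. x \<in> {-L..L} \<Longrightarrow> m \<le> f'' x"
    using continuous_attains_inf[OF compact_Icc ne assms(5)] assms(6) by metis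
  have "continuous_on {-L..L} f'"
    using assms(4) by (rule DERIV_continuous_on)
  then have "bounded (f' ` {-L..L})"
    by (intro compact_imp_bounded compact_continuous_image) auto
  then obtain B where B: "0 < B" "\<And>x. x \<in> {-L..L} \<Longrightarrow> \<bar>f' x\<bar> \<le> B"
    unfolding bounded_pos by auto
  have conv: "convex_on (ball 0 L) (\<lambda>u. gamma f u - m / 2 * (norm u)\<^sup>2)"
    by (rule strongly_convex_gamma[OF assms(1-4) m(2)])
  have lip: "B-lipschitz_on (ball 0 L) (gamma f)"
    using B by (intro lipschitz_on_gamma[OF assms(3)]) auto

  \<comment> \<open>The added 1 makes the inequality strict.\<close>
  define c where "c = \<bar>transversal_const TYPE(real^2) m B (L / 3)\<bar> + 1"
  have transversal: "emeasure lebesgue {\<alpha> \<in> cball 0 (L / 3). \<bar>Phi_pt f \<alpha> a - Phi_pt f \<alpha> a'\<bar> \<le> \<delta>}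
      < ennreal (c * (\<delta> / norm (a - a')))"
    if a: "a \<in> cball 0 (L / 3)" "a' \<in> cball 0 (L / 3)" "a \<noteq> a'" and \<delta>: "0 < \<delta>" for a a' \<delta>
  proof -
    have dom: "\<alpha> - fst p \<in> ball 0 L" if "\<alpha> \<in> cball 0 (L / 3)" "p \<in> cball 0 (L / 3)"
      for \<alpha> and p :: "(real^2) \<times> real"
    proof -
      have "norm (\<alpha> - fst p) \<le> L / 3 + L / 3"
        using that norm_fst_le[of "fst p" "snd p"] by (intro norm_triangle_le_diff) auto
      then show ?thesis
        using \<open>L > 0\<close> unfolding mem_ball_0 by linarith
    qed
    let ?S = "{\<alpha> \<in> cball 0 (L / 3). \<bar>Phi_pt f \<alpha> a - Phi_pt f \<alpha> a'\<bar> \<le> \<delta>}"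
    have L3: "0 < L / 3"
      using \<open>L > 0\<close> by simp
    note tr = graph_projection_transversal[OF m(1) B(1) L3 \<delta> conv lip dom dom a(3), of 0, folded Phi_pt_def]
    have "measure lebesgue ?S \<le> transversal_const TYPE(real^2) m B (L / 3) * (\<delta> / norm (a - a'))"
      using a by (intro tr(2))
    also have "\<dots> < c * (\<delta> / norm (a - a'))"
      using a \<delta> unfolding c_def by (intro mult_strict_right_mono) auto
    finally have "ennreal (measure lebesgue ?S) < ennreal (c * (\<delta> / norm (a - a')))"
      by (subst ennreal_less_iff) auto
    moreover have "emeasure lebesgue ?S = ennreal (measure lebesgue ?S)"
      using a by (intro emeasure_eq_measure2 tr(1))
    ultimately show ?thesis
      by simp
  qed

  interpret prob_space \<mu> by fact
  have space: "space \<mu> = UNIV"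
    using sets_eq_imp_space_eq[OF assms(8)] by simp
  have "E \<in> sets \<mu>" "- E \<in> sets \<mu>"
    using \<open>compact E\<close> by (auto simp: assms(8) compact_imp_closed)
  then have \<mu>E: "emeasure \<mu> E = 1"
    using plus_emeasure[of E \<mu> "- E"] assms(10) emeasure_space_1 by (simp add: space Compl_partition)
  then obtain x where "x \<in> E"
    by (cases "E = {}") auto
  \<comment> \<open>At radius 1 the power is 1, so b dominates the measure of a ball and is
    nonnegative.\<close>
  from assms(11)[OF this, of 1] have b: "0 \<le> b"
    using measure_nonneg[of \<mu> "ball x 1"] by (simp del: measure_nonneg)
  have "continuous_on {0..L} f"
    using \<open>L > 0\<close> by (intro continuous_on_subset[OF DERIV_continuous_on[OF assms(3)]]) auto
  then obtain \<kappa> where \<kappa>: "0 < \<kappa>"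
    "\<And>r K. 0 < r \<Longrightarrow> ennreal (\<kappa> * r / dyadic_energy b t K r) \<le> Fav (surface L f) (thickening E r)"
    using Fav_thickening_lower_bound[OF assms(1) m(1) B(1) _ conv lip assms(7,9,8) \<mu>E assms(11) b]
    by blast
  have Fav: "ennreal (\<kappa> * r / D) \<le> Fav (surface L f) (thickening E r)"
    if "0 < r" "dyadic_energy b t K r \<le> D" for r D K
  proof -
    have "\<kappa> * r / D \<le> \<kappa> * r / dyadic_energy b t K r"
      using that \<kappa>(1) dyadic_energy_pos[OF b, of t K r] by (intro divide_left_mono) (auto intro!: mult_pos_pos)
    then show ?thesis
      using \<kappa>(2)[OF that(1), of K] by (meson ennreal_leI order_trans)
  qed

  have "\<exists>c'>0. \<forall>\<^sub>F r in at_right 0. ennreal (c' * r powr (1 - t)) \<le> Fav (surface L f) (thickening E r)"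
    if t: "t < 1"
  proof -
    define d where "d = 2 * b / (1 - 2 powr (t - 1)) + 1"
    have "2 powr (t - 1) < (1::real)"
      using powr_less_mono[of "t - 1" 0 2] t by simp
    then have d: "0 < d"
      using b unfolding d_def by (intro add_nonneg_pos) auto
    have "ennreal (\<kappa> / d * r powr (1 - t)) \<le> Fav (surface L f) (thickening E r)" if r: "0 < r" for r
    proof -
      obtain K where "dyadic_energy b t K r \<le> d * r powr t"
        using dyadic_energy_subcritical[OF b t r] unfolding d_def by blast
      from Fav[OF r this] show ?thesis
        using r by (simp add: powr_diff)
    qed
    then show ?thesis
      using \<kappa>(1) d by (intro exI[of _ "\<kappa> / d"]) (auto simp: eventually_at_right_less intro: eventually_at_rightI[of 0 1])
  qed
  moreover have "\<exists>c'>0. \<forall>\<^sub>F r in at_right 0.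
      ennreal (c' * inverse (ln (inverse r))) \<le> Fav (surface L f) (thickening E r)"
    if t: "t = 1"
  proof -
    define d where "d = 4 * b / ln 2 + 1"
    have d: "0 < d"
      using b unfolding d_def by (intro add_nonneg_pos) auto
    have "ennreal (\<kappa> / d * inverse (ln (inverse r))) \<le> Fav (surface L f) (thickening E r)"
      if r: "0 < r" "r \<le> 1 / 4" for r
    proof -
      obtain K where "dyadic_energy b t K r \<le> d * (r * ln (inverse r))"
        using dyadic_energy_critical[OF b r] unfolding d_def t by blast
      from Fav[OF r(1) this] have "ennreal (\<kappa> * r / (d * (r * ln (inverse r)))) \<le> Fav (surface L f) (thickening E r)" .
      also have "\<kappa> * r / (d * (r * l)) = \<kappa> / d * inverse l" for l
        using r(1) by (simp add: divide_inverse)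
      finally show ?thesis .
    qed
    then show ?thesis
      using \<kappa>(1) d by (intro exI[of _ "\<kappa> / d"]) (auto intro: eventually_at_rightI[of 0 "1/4"])
  qed
  moreover have "\<exists>c>0. \<exists>\<delta>\<^sub>0>0. \<forall>a\<in>cball 0 (L / 3). \<forall>a'\<in>cball 0 (L / 3). \<forall>\<delta>.
      a \<noteq> a' \<longrightarrow> 0 < \<delta> \<longrightarrow> \<delta> \<le> \<delta>\<^sub>0 \<longrightarrow>
      emeasure lebesgue {\<alpha> \<in> cball 0 (L / 3). \<bar>Phi_pt f \<alpha> a - Phi_pt f \<alpha> a'\<bar> \<le> \<delta>}
        < ennreal (c * (\<delta> / norm (a - a')))"
  \<comment> \<open>Both witnesses are c: \<open>transversal\<close> covers every positive \<delta>,
    so \<delta>0 can be any positive number.\<close>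
  proof (intro exI[of _ c] conjI ballI allI impI)
    show "0 < c" "0 < c"
      by (simp_all add: c_def)
  qed (rule transversal)
  ultimately show ?thesis
    by blast
qed

end
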